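(* Let $(X,d)$ be an infinite metric space and let $\mathfrak{B}$ be a bornology on $X$ with a closed base such that $X\notin\mathfrak{B}$. The following statements are equivalent. (1) $(C(X),\tau^s_{\mathfrak{B}})$ has countable strong fan tightness. (2) $(C(X),\tau^s_{\mathfrak{B}})$ has countable strong fan tightness for finite sets. (3) $(C(X),\tau^s_{\mathfrak{B}})$ has Id-fan tightness. (4) $X$ satisfies the selection principle $\mathsf{S}_1(\mathcal{O}_{\mathfrak{B}^s},\mathcal{O}_{\mathfrak{B}^s})$.
   Context: A bornology on a set $X$ is a family $\mathfrak{B}$ of subsets of $X$ that covers $X$, is closed under finite unions and is closed under taking subsets. A base of $\mathfrak{B}$ is a subfamily $\mathfrak{B}_0\subseteq\mathfrak{B}$ such that every $B\in\mathfrak{B}$ is contained in some $B_0\in\mathfrak{B}_0$; it is a closed base if all its members are closed in $X$. For $B\subseteq X$ and $\delta>0$, $B^\delta=\bigcup_{x\in B}\{y\in X: d(x,y)<\delta\}$. $C(X)$ is the set of continuous functions $X\to\mathbb{R}$. The topology $\tau^s_{\mathfrak{B}}$ of strong uniform convergence on $\mathfrak{B}$ is the topology on $C(X)$ induced by the uniformity with base consisting of the sets $[B,\varepsilon]^s=\{(f,g): \exists\delta>0\ \forall x\in B^\delta,\ |f(x)-g(x)|<\varepsilon\}$, $B\in\mathfrak{B}$, $\varepsilon>0$. An open $\mathfrak{B}^s$-cover of $X$ is a family $\mathcal{U}$ of open subsets of $X$ that covers $X$ with $X\notin\mathcal{U}$ such that for every $B\in\mathfrak{B}$ there are $U\in\mathcal{U}$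 and $\delta>0$ with $B^\delta\subseteq U$. $\mathcal{O}_{\mathfrak{B}^s}$ is the collection of all open $\mathfrak{B}^s$-covers of $X$. $\mathsf{S}_1(\mathcal{A},\mathcal{C})$ means: for every sequence $(A_n)_{n\in\mathbb{N}}$ of elements of $\mathcal{A}$ one can choose $a_n\in A_n$ for each $n$ such that $\{a_n:n\in\mathbb{N}\}\in\mathcal{C}$. For a topological space $Y$: - Countable strong fan tightness: for every $y\in Y$ and every sequence $(A_n)$ of subsets of $Y$ with $y\in\overline{A_n}$ for all $n$, there are $y_n\in A_n$ with $y\in\overline{\{y_n:n\in\mathbb{N}\}}$. - A family $\mathcal{A}$ of subsets of $Y$ is a $\pi$-network at $y$ if every neighbourhood of $y$ contains a member of $\mathcal{A}$. Countable strong fan tightness for finite sets: for every $y\in Y$ and every sequence $(\mathcal{A}_n)$ of $\pi$-networks at $y$ consisting of finite subsets of $Y$, there are $A_n\in\mathcal{A}_n$ such that $\{A_n:n\in\mathbb{N}\}$ is a $\pi$-network at $y$. - Id-fan tightness: for every $y\in Y$ and every sequence $(A_n)_{n\in\mathbb{N}}$ of subsets of $Y$ with $y\in\overline{A_n}$ for all $n$, there are $F_n\subseteq A_n$ with $|F_n|\le n$ such that $y\in\overline{\bigcup_n F_n}$. Here $\mathbb{N}=\{1,2,\dots\}$. *)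

theory Defs
  imports "HOL-Analysis.Analysis"
begin

definition bornology :: "'a set set \<Rightarrow> bool" where
  "bornology \<BB> \<longleftrightarrow>
     \<Union>\<BB> = UNIV \<and>
     (\<forall>\<F>. finite \<F> \<and> \<F> \<subseteq> \<BB> \<longrightarrow> \<Union>\<F> \<in> \<BB>) \<and>
     (\<forall>B\<in>\<BB>. \<forall>A. A \<subseteq> B \<longrightarrow> A \<in> \<BB>)"

definition bornology_base :: "'a set set \<Rightarrow> 'a set set \<Rightarrow> bool" where
  "bornology_base \<BB>\<^sub>0 \<BB> \<longleftrightarrow> \<BB>\<^sub>0 \<subseteq> \<BB> \<and> (\<forall>B\<in>\<BB>. \<exists>B\<^sub>0\<in>\<BB>\<^sub>0. B \<subseteq> B\<^sub>0)"

definition has_closed_base :: "'a::topological_space set set \<Rightarrow> bool" where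
  "has_closed_base \<BB> \<longleftrightarrow> (\<exists>\<BB>\<^sub>0. bornology_base \<BB>\<^sub>0 \<BB> \<and> (\<forall>B\<in>\<BB>\<^sub>0. closed B))"

definition enlargement :: "'a::metric_space set \<Rightarrow> real \<Rightarrow> 'a set" where
  "enlargement B \<delta> = (\<Union>x\<in>B. {y. dist x y < \<delta>})"

definition C_space :: "('a::topological_space \<Rightarrow> real) set" where
  "C_space = {f. continuous_on UNIV f}"

definition strong_entourage ::
    "'a::metric_space set \<Rightarrow> real \<Rightarrow> (('a \<Rightarrow> real) \<times> ('a \<Rightarrow> real)) set" where
  "strong_entourage B \<epsilon> =
     {(f, g). f \<in> C_space \<and> g \<in> C_space \<and>
              (\<exists>\<delta>>0. \<forall>x\<in>enlargement B \<delta>. \<bar>f x - g x\<bar> < \<epsilon>)}"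

definition strong_uniformity ::
    "'a::metric_space set set \<Rightarrow> (('a \<Rightarrow> real) \<times> ('a \<Rightarrow> real)) set set" where
  "strong_uniformity \<BB> =
     {V. V \<subseteq> C_space \<times> C_space \<and> (\<exists>B\<in>\<BB>. \<exists>\<epsilon>>0. strong_entourage B \<epsilon> \<subseteq> V)}"

text \<open>The library's uniform spaces are tied to a type class, so the passage from a uniformity on
  a set \<open>S\<close>, given as the set of its entourages, to the induced topology is spelled out here.\<close>

definition uniformity_topology :: "'b set \<Rightarrow> ('b \<times> 'b) set set \<Rightarrow> 'b topology" where
  "uniformity_topology S \<V> =
     topology (\<lambda>U. U \<subseteq> S \<and> (\<forall>f\<in>U. \<exists>V\<in>\<V>. V `` {f} \<subseteq> U))"

definition strong_topology :: "'a::metric_space set set \<Rightarrow> ('a \<Rightarrow> real) topology" where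
  "strong_topology \<BB> = uniformity_topology C_space (strong_uniformity \<BB>)"

lemma strong_entourage_mono:
  assumes "B \<subseteq> B'" "\<epsilon>' \<le> \<epsilon>"
  shows "strong_entourage B' \<epsilon>' \<subseteq> strong_entourage B \<epsilon>"
  using assms unfolding strong_entourage_def enlargement_def by fastforce

lemma strong_uniformity_Int:
  assumes "bornology \<BB>" "V \<in> strong_uniformity \<BB>" "W \<in> strong_uniformity \<BB>"
  shows "V \<inter> W \<in> strong_uniformity \<BB>"
proof -
  obtain B \<epsilon> where B: "B \<in> \<BB>" "\<epsilon> > 0" "strong_entourage B \<epsilon> \<subseteq> V"
    using assms(2) unfolding strong_uniformity_def by auto
  obtain B' \<epsilon>' where B': "B' \<in> \<BB>" "\<epsilon>' > 0" "strong_entourage B' \<epsilon>' \<subseteq> W"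
    using assms(3) unfolding strong_uniformity_def by auto
  have "finite {B, B'} \<and> {B, B'} \<subseteq> \<BB>" using B(1) B'(1) by simp
  then have "\<Union>{B, B'} \<in> \<BB>"
    using assms(1) unfolding bornology_def by blast
  then have U: "B \<union> B' \<in> \<BB>" by simp
  have "strong_entourage (B \<union> B') (min \<epsilon> \<epsilon>') \<subseteq> V \<inter> W"
    using B(3) B'(3) strong_entourage_mono[of B "B \<union> B'" "min \<epsilon> \<epsilon>'" \<epsilon>]
      strong_entourage_mono[of B' "B \<union> B'" "min \<epsilon> \<epsilon>'" \<epsilon>'] by auto
  moreover have "min \<epsilon> \<epsilon>' > 0" using B(2) B'(2) by simp
  moreover have "V \<inter> W \<subseteq> C_space \<times> C_space"
    using assms(2) unfolding strong_uniformity_def by auto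
  ultimately show ?thesis
    using U unfolding strong_uniformity_def by blast
qed

lemma openin_strong_topology:
  assumes "bornology \<BB>"
  shows "openin (strong_topology \<BB>) U \<longleftrightarrow>
           U \<subseteq> C_space \<and> (\<forall>f\<in>U. \<exists>V\<in>strong_uniformity \<BB>. V `` {f} \<subseteq> U)"
proof -
  have "istopology (\<lambda>U. U \<subseteq> C_space \<and> (\<forall>f\<in>U. \<exists>V\<in>strong_uniformity \<BB>. V `` {f} \<subseteq> U))"
    unfolding istopology_def
  proof (intro conjI allI impI)
    fix S T
    assume S: "S \<subseteq> C_space \<and> (\<forall>f\<in>S. \<exists>V\<in>strong_uniformity \<BB>. V `` {f} \<subseteq> S)"
      and T: "T \<subseteq> C_space \<and> (\<forall>f\<in>T. \<exists>V\<in>strong_uniformity \<BB>. V `` {f} \<subseteq> T)"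
    show "S \<inter> T \<subseteq> C_space" using S by auto
    show "\<forall>f\<in>S \<inter> T. \<exists>V\<in>strong_uniformity \<BB>. V `` {f} \<subseteq> S \<inter> T"
    proof
      fix f assume "f \<in> S \<inter> T"
      then obtain V W where "V \<in> strong_uniformity \<BB>" "V `` {f} \<subseteq> S"
        "W \<in> strong_uniformity \<BB>" "W `` {f} \<subseteq> T" using S T by blast
      then show "\<exists>V\<in>strong_uniformity \<BB>. V `` {f} \<subseteq> S \<inter> T"
        using strong_uniformity_Int[OF assms] by (intro bexI[of _ "V \<inter> W"]) auto
    qed
  next
    fix \<K> :: "('a \<Rightarrow> real) set set"
    assume K: "\<forall>K\<in>\<K>. K \<subseteq> C_space \<and> (\<forall>f\<in>K. \<exists>V\<in>strong_uniformity \<BB>. V `` {f} \<subseteq> K)"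
    show "\<Union>\<K> \<subseteq> C_space" using K by blast
    show "\<forall>f\<in>\<Union>\<K>. \<exists>V\<in>strong_uniformity \<BB>. V `` {f} \<subseteq> \<Union>\<K>"
      using K by (meson UnionE Union_upper order_trans)
  qed
  then show ?thesis
    unfolding strong_topology_def uniformity_topology_def by simp
qed

lemma topspace_strong_topology:
  assumes "bornology \<BB>"
  shows "topspace (strong_topology \<BB>) = C_space"
proof
  show "topspace (strong_topology \<BB>) \<subseteq> C_space"
    using openin_strong_topology[OF assms] openin_topspace by blast
  have "{} \<in> \<BB>"
    using assms unfolding bornology_def by (metis Union_empty empty_subsetI finite.emptyI)
  then have "strong_entourage {} 1 \<in> strong_uniformity \<BB>"
    unfolding strong_uniformity_def
    by (intro CollectI conjI bexI[of _ "{}"] exI[of _ 1]) (auto simp: strong_entourage_def)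
  moreover have "strong_entourage {} 1 `` {f} \<subseteq> C_space" for f :: "'a \<Rightarrow> real"
    by (auto simp: strong_entourage_def)
  ultimately have "openin (strong_topology \<BB>) C_space"
    unfolding openin_strong_topology[OF assms] by blast
  then show "C_space \<subseteq> topspace (strong_topology \<BB>)"
    by (rule openin_subset)
qed

definition open_Bs_covers :: "'a::metric_space set set \<Rightarrow> 'a set set set" where
  "open_Bs_covers \<BB> =
     {\<U>. (\<forall>U\<in>\<U>. open U) \<and> \<Union>\<U> = UNIV \<and> UNIV \<notin> \<U> \<and>
          (\<forall>B\<in>\<BB>. \<exists>U\<in>\<U>. \<exists>\<delta>>0. enlargement B \<delta> \<subseteq> U)}"

definition S1 :: "'b set set \<Rightarrow> 'b set set \<Rightarrow> bool" where
  "S1 \<A> \<C> \<longleftrightarrow>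
     (\<forall>A :: nat \<Rightarrow> 'b set. (\<forall>n. A n \<in> \<A>) \<longrightarrow>
        (\<exists>a. (\<forall>n. a n \<in> A n) \<and> range a \<in> \<C>))"

definition countable_strong_fan_tightness :: "'b topology \<Rightarrow> bool" where
  "countable_strong_fan_tightness Y \<longleftrightarrow>
     (\<forall>y\<in>topspace Y. \<forall>A :: nat \<Rightarrow> 'b set.
        (\<forall>n. A n \<subseteq> topspace Y \<and> y \<in> Y closure_of A n) \<longrightarrow>
        (\<exists>z. (\<forall>n. z n \<in> A n) \<and> y \<in> Y closure_of range z))"

definition pi_network_at :: "'b topology \<Rightarrow> 'b \<Rightarrow> 'b set set \<Rightarrow> bool" where
  "pi_network_at Y y \<A> \<longleftrightarrow>
     (\<forall>A\<in>\<A>. A \<subseteq> topspace Y) \<and>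
     (\<forall>N. N \<subseteq> topspace Y \<and> (\<exists>U. openin Y U \<and> y \<in> U \<and> U \<subseteq> N) \<longrightarrow> (\<exists>A\<in>\<A>. A \<subseteq> N))"

definition countable_strong_fan_tightness_finite_sets :: "'b topology \<Rightarrow> bool" where
  "countable_strong_fan_tightness_finite_sets Y \<longleftrightarrow>
     (\<forall>y\<in>topspace Y. \<forall>\<A> :: nat \<Rightarrow> 'b set set.
        (\<forall>n. pi_network_at Y y (\<A> n) \<and> (\<forall>A\<in>\<A> n. finite A)) \<longrightarrow>
        (\<exists>A. (\<forall>n. A n \<in> \<A> n) \<and> pi_network_at Y y (range A)))"

text \<open>Here the indices start at 1, since the bound on the size of \<open>F n\<close> depends on \<open>n\<close>.
  Finiteness is explicit because \<open>card\<close> is 0 on infinite sets.\<close>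

definition Id_fan_tightness :: "'b topology \<Rightarrow> bool" where
  "Id_fan_tightness Y \<longleftrightarrow>
     (\<forall>y\<in>topspace Y. \<forall>A :: nat \<Rightarrow> 'b set.
        (\<forall>n\<ge>1. A n \<subseteq> topspace Y \<and> y \<in> Y closure_of A n) \<longrightarrow>
        (\<exists>F. (\<forall>n\<ge>1. F n \<subseteq> A n \<and> finite (F n) \<and> card (F n) \<le> n) \<and>
             y \<in> Y closure_of (\<Union>n\<in>{1..}. F n)))"

end

theory Submission
  imports Defs
begin

text \<open>The nontrivial implications are from the selection principle to fan tightness for finite sets
  and from Id-fan tightness to the selection principle. For the former, a finite set \<open>A\<close> of the
  \<open>n\<close>-th \<open>\<pi>\<close>-network at \<open>f\<close> is turned into the open set of points where all members of \<open>A\<close> are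
  within \<open>1/(n+1)\<close> of \<open>f\<close>; a selected cover contains the enlargement of each \<open>B\<close> in sets of
  arbitrarily large index, because adding to \<open>B\<close> finitely many points rules out any finitely many
  sets of the cover. For the latter, covers are grouped into blocks of length \<open>n\<close>, and the \<open>n\<close>-th
  set of functions consists of those that, for each cover of the \<open>n\<close>-th block, equal 1 off some
  member of it. The at most \<open>n\<close> functions picked from it can then be distributed among the \<open>n\<close>
  covers of the block.\<close>

section \<open>Neighbourhoods in the strong topology\<close>

lemma mem_enlargement: "y \<in> enlargement B \<delta> \<longleftrightarrow> (\<exists>x\<in>B. dist x y < \<delta>)"
  unfolding enlargement_def by auto

lemma enlargement_mono:
  assumes "B \<subseteq> B'" "\<delta> \<le> \<delta>'"
  shows "enlargement B \<delta> \<subseteq> enlargement B' \<delta>'"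
  using assms unfolding enlargement_def by fastforce

lemma subset_enlargement: "\<delta> > 0 \<Longrightarrow> B \<subseteq> enlargement B \<delta>"
  by (force simp: mem_enlargement)

lemma bornology_empty: "bornology \<BB> \<Longrightarrow> {} \<in> \<BB>"
  unfolding bornology_def by (metis Union_empty empty_subsetI finite.emptyI)

lemma bornology_Un:
  assumes "bornology \<BB>" "A \<in> \<BB>" "B \<in> \<BB>"
  shows "A \<union> B \<in> \<BB>"
proof -
  have "finite {A, B} \<and> {A, B} \<subseteq> \<BB>" using assms by simp
  then have "\<Union>{A, B} \<in> \<BB>"
    using assms(1) unfolding bornology_def by blast
  then show ?thesis by simp
qed

lemma bornology_singleton:
  assumes "bornology \<BB>"
  shows "{x} \<in> \<BB>"
proof -
  obtain B where "B \<in> \<BB>" "x \<in> B" using assms unfolding bornology_def by blast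
  moreover have "\<forall>B\<in>\<BB>. \<forall>A. A \<subseteq> B \<longrightarrow> A \<in> \<BB>"
    using assms unfolding bornology_def by (elim conjE)
  ultimately show ?thesis by simp
qed

lemma bornology_finite:
  assumes "bornology \<BB>" "finite F"
  shows "F \<in> \<BB>"
  using assms(2)
proof (induction F rule: finite_induct)
  case empty
  then show ?case using assms(1) by (rule bornology_empty)
next
  case (insert x F)
  then show ?case
    using bornology_Un[OF assms(1) bornology_singleton[OF assms(1)], of F x] by simp
qed

section \<open>Sections of entourages as basic neighbourhoods\<close>

lemma openin_strong_topology_entourage:
  assumes "bornology \<BB>" "openin (strong_topology \<BB>) U" "f \<in> U"
  obtains B \<epsilon> where "B \<in> \<BB>" "\<epsilon> > 0" "strong_entourage B \<epsilon> `` {f} \<subseteq> U"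
proof -
  obtain V where "V \<in> strong_uniformity \<BB>" "V `` {f} \<subseteq> U"
    using assms openin_strong_topology by blast
  then obtain B \<epsilon> where "B \<in> \<BB>" "\<epsilon> > 0" "strong_entourage B \<epsilon> \<subseteq> V"
    unfolding strong_uniformity_def by blast
  then show thesis using that \<open>V `` {f} \<subseteq> U\<close> by blast
qed

text \<open>The section of the entourage at \<open>f\<close> may fail to be open, since the
  difference from \<open>f\<close> may approach \<epsilon>. Requiring a bound strictly below
  \<epsilon> leaves room for perturbations.\<close>

lemma strong_entourage_open_nhd:
  assumes b: "bornology \<BB>" and B: "B \<in> \<BB>" and e: "\<epsilon> > 0" and f: "f \<in> C_space"
  obtains W where "openin (strong_topology \<BB>) W" "f \<in> W" "W \<subseteq> strong_entourage B \<epsilon> `` {f}"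
proof -
  define W where "W = {g \<in> C_space. \<exists>\<delta>>0. \<exists>\<eta><\<epsilon>. \<forall>x\<in>enlargement B \<delta>. \<bar>f x - g x\<bar> < \<eta>}"
  have "\<exists>V\<in>strong_uniformity \<BB>. V `` {g} \<subseteq> W" if g: "g \<in> W" for g
  proof -
    obtain \<delta> \<eta> where d: "\<delta> > 0" "\<eta> < \<epsilon>" "\<And>x. x \<in> enlargement B \<delta> \<Longrightarrow> \<bar>f x - g x\<bar> < \<eta>"
      using g unfolding W_def by blast
    \<comment> \<open>Spending half of the slack \<epsilon> - \<eta> keeps the new bound (\<epsilon>
      + \<eta>)/2 strictly below \<epsilon>.\<close>
    let ?V = "strong_entourage B ((\<epsilon> - \<eta>) / 2)"
    have "(\<epsilon> - \<eta>) / 2 > 0" using d(2) by simp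
    then have "?V \<in> strong_uniformity \<BB>"
      unfolding strong_uniformity_def using B
      by (intro CollectI conjI bexI[of _ B] exI[of _ "(\<epsilon> - \<eta>) / 2"]) (auto simp: strong_entourage_def)
    moreover have "?V `` {g} \<subseteq> W"
    proof
      fix h assume "h \<in> ?V `` {g}"
      then obtain \<delta>' where h: "h \<in> C_space" "\<delta>' > 0"
        "\<And>x. x \<in> enlargement B \<delta>' \<Longrightarrow> \<bar>g x - h x\<bar> < (\<epsilon> - \<eta>) / 2"
        unfolding strong_entourage_def by blast
      have "\<bar>f x - h x\<bar> < (\<epsilon> + \<eta>) / 2" if "x \<in> enlargement B (min \<delta> \<delta>')" for x
      proof -
        have "\<bar>f x - g x\<bar> < \<eta>" "\<bar>g x - h x\<bar> < (\<epsilon> - \<eta>) / 2"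
          using that d(3) h(3) by (auto simp: mem_enlargement)
        then show ?thesis by (simp add: field_simps abs_if split: if_splits)
      qed
      moreover have "min \<delta> \<delta>' > 0" "(\<epsilon> + \<eta>) / 2 < \<epsilon>" using d h by auto
      ultimately show "h \<in> W" unfolding W_def using h(1) by blast
    qed
    ultimately show ?thesis by blast
  qed
  moreover have "W \<subseteq> C_space" unfolding W_def by blast
  ultimately have "openin (strong_topology \<BB>) W"
    unfolding openin_strong_topology[OF b] by blast
  moreover have "f \<in> W"
    unfolding W_def using f e by (auto intro!: exI[of _ 1] exI[of _ "\<epsilon>/2"])
  moreover have "W \<subseteq> strong_entourage B \<epsilon> `` {f}"
    unfolding W_def strong_entourage_def using f by fastforce
  ultimately show thesis using that by blast
qed

text \<open>The sections of basic entourages at \<open>f\<close> form a neighbourhood base, so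
  testing against them suffices. This frees the later arguments in the function space from open sets
  of functions.\<close>

lemma in_closure_of_strong_topology:
  assumes "bornology \<BB>" "f \<in> C_space"
  shows "f \<in> strong_topology \<BB> closure_of A \<longleftrightarrow>
           (\<forall>B\<in>\<BB>. \<forall>\<epsilon>>0. \<exists>g\<in>A. (f, g) \<in> strong_entourage B \<epsilon>)" (is "?L \<longleftrightarrow> ?R")
proof
  assume L: ?L
  show ?R
  proof (intro ballI allI impI)
    fix B and \<epsilon> :: real assume "B \<in> \<BB>" "\<epsilon> > 0"
    then obtain W where "openin (strong_topology \<BB>) W" "f \<in> W" "W \<subseteq> strong_entourage B \<epsilon> `` {f}"
      using strong_entourage_open_nhd assms by metis
    then show "\<exists>g\<in>A. (f, g) \<in> strong_entourage B \<epsilon>"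
      using L unfolding in_closure_of by blast
  qed
next
  assume R: ?R
  have "\<exists>g\<in>A. g \<in> U" if U: "openin (strong_topology \<BB>) U" "f \<in> U" for U
  proof -
    obtain B \<epsilon> where "B \<in> \<BB>" "\<epsilon> > 0" "strong_entourage B \<epsilon> `` {f} \<subseteq> U"
      using openin_strong_topology_entourage[OF assms(1) U] .
    moreover from this R obtain g where "g \<in> A" "(f, g) \<in> strong_entourage B \<epsilon>" by metis
    ultimately show ?thesis by (intro bexI[of _ g]) auto
  qed
  then show ?L
    unfolding in_closure_of topspace_strong_topology[OF assms(1)] using assms(2) by blast
qed

text \<open>Rests on the same neighbourhood base; a section contains only continuous functions, so
  it is itself an admissible neighbourhood.\<close>

lemma pi_network_at_strong_topology:
  assumes "bornology \<BB>" "f \<in> C_space"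
  shows "pi_network_at (strong_topology \<BB>) f \<A> \<longleftrightarrow>
           (\<forall>A\<in>\<A>. A \<subseteq> C_space) \<and>
           (\<forall>B\<in>\<BB>. \<forall>\<epsilon>>0. \<exists>A\<in>\<A>. A \<subseteq> strong_entourage B \<epsilon> `` {f})" (is "?L \<longleftrightarrow> ?S \<and> ?R")
proof
  assume L: ?L
  then have ?S
    unfolding pi_network_at_def topspace_strong_topology[OF assms(1)] by blast
  moreover have ?R
  proof (intro ballI allI impI)
    fix B and \<epsilon> :: real assume "B \<in> \<BB>" "\<epsilon> > 0"
    then obtain W where "openin (strong_topology \<BB>) W" "f \<in> W" "W \<subseteq> strong_entourage B \<epsilon> `` {f}"
      using strong_entourage_open_nhd assms by metis
    moreover have "strong_entourage B \<epsilon> `` {f} \<subseteq> C_space"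
      unfolding strong_entourage_def by blast
    ultimately show "\<exists>A\<in>\<A>. A \<subseteq> strong_entourage B \<epsilon> `` {f}"
      using L unfolding pi_network_at_def topspace_strong_topology[OF assms(1)] by blast
  qed
  ultimately show "?S \<and> ?R" by blast
next
  assume R: "?S \<and> ?R"
  have "\<exists>A\<in>\<A>. A \<subseteq> N" if U: "openin (strong_topology \<BB>) U" "f \<in> U" "U \<subseteq> N" for U N
  proof -
    obtain B \<epsilon> where "B \<in> \<BB>" "\<epsilon> > 0" "strong_entourage B \<epsilon> `` {f} \<subseteq> U"
      using openin_strong_topology_entourage[OF assms(1) U(1,2)] .
    moreover from this obtain A where "A \<in> \<A>" "A \<subseteq> strong_entourage B \<epsilon> `` {f}"
      using R by blast
    ultimately show ?thesis using U(3) by blast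
  qed
  then show ?L
    unfolding pi_network_at_def topspace_strong_topology[OF assms(1)] using R by metis
qed

section \<open>Open covers\<close>

text \<open>Covering the space is automatic: singletons belong to the bornology, and a set
  containing an enlargement of {x} contains x.\<close>

lemma open_Bs_coversI:
  assumes "bornology \<BB>" "\<And>U. U \<in> \<U> \<Longrightarrow> open U" "UNIV \<notin> \<U>"
    and "\<And>B. B \<in> \<BB> \<Longrightarrow> \<exists>U\<in>\<U>. \<exists>\<delta>>0. enlargement B \<delta> \<subseteq> U"
  shows "\<U> \<in> open_Bs_covers \<BB>"
proof -
  have "x \<in> \<Union>\<U>" for x
  proof -
    obtain U \<delta> where "U \<in> \<U>" "\<delta> > 0" "enlargement {x} \<delta> \<subseteq> U"
      using assms(4) bornology_singleton[OF assms(1)] by blast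
    then show ?thesis using subset_enlargement[of \<delta> "{x}"] by blast
  qed
  then have "\<Union>\<U> = UNIV" by blast
  then show ?thesis unfolding open_Bs_covers_def using assms by auto
qed

text \<open>Supplies the large indices at which the tolerance 1/(n+1) drops below a prescribed
  \<epsilon>.\<close>

lemma open_Bs_cover_large_index:
  fixes a :: "nat \<Rightarrow> 'a::metric_space set"
  assumes "bornology \<BB>" "range a \<in> open_Bs_covers \<BB>" "B \<in> \<BB>"
  obtains n \<delta> where "n \<ge> k" "\<delta> > 0" "enlargement B \<delta> \<subseteq> a n"
proof -
  have "\<exists>x. x \<notin> a i" for i
  proof -
    have "UNIV \<notin> range a" using assms(2) by (simp add: open_Bs_covers_def)
    then have "a i \<noteq> UNIV" by (metis rangeI)
    then show ?thesis by blast
  qed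
  then obtain p where p: "\<And>i. p i \<notin> a i" by metis
  have "B \<union> p ` {..<k} \<in> \<BB>"
    using assms bornology_Un bornology_finite by blast
  then obtain n \<delta> where n: "\<delta> > 0" "enlargement (B \<union> p ` {..<k}) \<delta> \<subseteq> a n"
    using assms(2) unfolding open_Bs_covers_def by blast
  have "p i \<in> a n" if "i < k" for i
    using subset_enlargement[OF n(1), of "B \<union> p ` {..<k}"] n(2) that by blast
  then have "n \<ge> k" using p by (meson not_le)
  moreover have "enlargement B \<delta> \<subseteq> a n"
    using n(2) enlargement_mono[of B "B \<union> p ` {..<k}" \<delta> \<delta>] by blast
  ultimately show thesis using that n(1) by blast
qed

lemma separating_function:
  fixes B :: "'a::metric_space set"
  assumes "\<delta> > 0"
  obtains g :: "'a \<Rightarrow> real" where "continuous_on UNIV g"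
    "\<And>x. x \<in> enlargement B (\<delta>/2) \<Longrightarrow> g x = 0" "\<And>x. x \<notin> enlargement B \<delta> \<Longrightarrow> g x = 1"
proof (cases "B = {}")
  case True
  \<comment> \<open>All enlargements of the empty set are empty, so only the value 1 is demanded.
    The formula of the other case would give 0, because \<open>infdist x {} = 0\<close>.\<close>
  show thesis
    by (rule that[of "\<lambda>_. 1"]) (auto simp: True mem_enlargement)
next
  case False
  \<comment> \<open>The affine function 2t/\<delta> - 1 of the distance t is 0 at t = \<delta>/2 and
    1 at t = \<delta>; truncation makes it constant outside that range.\<close>
  let ?g = "\<lambda>x. min 1 (max 0 (2 * infdist x B / \<delta> - 1))"
  show thesis
  proof (rule that[of ?g])
    show "continuous_on UNIV ?g" using assms by (intro continuous_intros) auto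
  next
    fix x assume "x \<in> enlargement B (\<delta>/2)"
    then obtain b where "b \<in> B" "dist x b < \<delta>/2" by (auto simp: mem_enlargement dist_commute)
    then have "infdist x B < \<delta>/2" using infdist_le[of b B x] by simp
    then show "?g x = 0" using assms by (simp add: field_simps)
  next
    fix x assume "x \<notin> enlargement B \<delta>"
    then have "\<delta> \<le> dist x b" if "b \<in> B" for b
      using that by (auto simp: mem_enlargement dist_commute not_less)
    then have "\<delta> \<le> infdist x B"
      unfolding infdist_notempty[OF False] using False by (intro cINF_greatest) auto
    then show "?g x = 1" using assms by (simp add: field_simps)
  qed
qed

section \<open>Fan tightness and the selection principle\<close>

text \<open>Closure membership of a point means that the singletons from the set form a
  \<pi>-network at it, so points are selected by selecting singletons.\<close>

lemma strong_fan_tightness_if_finite_sets: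
  assumes "countable_strong_fan_tightness_finite_sets Y"
  shows "countable_strong_fan_tightness Y"
  unfolding countable_strong_fan_tightness_def
proof (intro ballI allI impI)
  fix y and A :: "nat \<Rightarrow> 'a set"
  assume y: "y \<in> topspace Y" and A: "\<forall>n. A n \<subseteq> topspace Y \<and> y \<in> Y closure_of A n"
  have "pi_network_at Y y ((\<lambda>a. {a}) ` A n) \<and> (\<forall>F\<in>(\<lambda>a. {a}) ` A n. finite F)" for n
  proof -
    have "\<exists>a\<in>A n. a \<in> U" if "openin Y U" "y \<in> U" for U
    proof -
      have "y \<in> Y closure_of A n" using A by blast
      then show ?thesis using that unfolding in_closure_of by blast
    qed
    then have "\<exists>F\<in>(\<lambda>a. {a}) ` A n. F \<subseteq> N" if "\<exists>U. openin Y U \<and> y \<in> U \<and> U \<subseteq> N" for N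
      using that by fastforce
    moreover have "A n \<subseteq> topspace Y" using A by blast
    ultimately show ?thesis unfolding pi_network_at_def by auto
  qed
  then have H: "\<forall>n. pi_network_at Y y ((\<lambda>a. {a}) ` A n) \<and> (\<forall>F\<in>(\<lambda>a. {a}) ` A n. finite F)" ..
  obtain F where F: "\<forall>n. F n \<in> (\<lambda>a. {a}) ` A n" "pi_network_at Y y (range F)"
    using assms[unfolded countable_strong_fan_tightness_finite_sets_def, THEN bspec, OF y,
      THEN spec, THEN mp, OF H] by (elim exE conjE) (rule that)
  have "\<exists>a\<in>A n. F n = {a}" for n using F(1)[THEN spec, of n] by (elim imageE) auto
  then obtain z where z: "\<And>n. z n \<in> A n" "\<And>n. F n = {z n}" by metis
  have "\<exists>n. z n \<in> U" if U: "openin Y U" "y \<in> U" for U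
  proof -
    have "\<exists>G\<in>range F. G \<subseteq> U"
      using F(2) U openin_subset[OF U(1)] unfolding pi_network_at_def by blast
    then show ?thesis using z(2) by auto
  qed
  then have "y \<in> Y closure_of range z" unfolding in_closure_of using y by blast
  then show "\<exists>z. (\<forall>n. z n \<in> A n) \<and> y \<in> Y closure_of range z" using z by blast
qed

text \<open>One point per set respects the bound \<open>n\<close> as soon as n \<ge> 1; what remains
  is a shift of indices.\<close>

lemma Id_fan_tightness_if_strong_fan_tightness:
  assumes "countable_strong_fan_tightness Y"
  shows "Id_fan_tightness Y"
  unfolding Id_fan_tightness_def
proof (intro ballI allI impI)
  fix y and A :: "nat \<Rightarrow> 'a set"
  assume y: "y \<in> topspace Y" and A: "\<forall>n\<ge>1. A n \<subseteq> topspace Y \<and> y \<in> Y closure_of A n"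
  then have "\<forall>n. A (Suc n) \<subseteq> topspace Y \<and> y \<in> Y closure_of A (Suc n)" by simp
  then obtain z where z: "\<And>n. z n \<in> A (Suc n)" "y \<in> Y closure_of range z"
    using assms[unfolded countable_strong_fan_tightness_def, rule_format, OF y, of "\<lambda>n. A (Suc n)"]
    by blast
  \<comment> \<open>Truncated subtraction makes \<open>F 0\<close> equal to \<open>{z 0}\<close>,
    which is harmless as index 0 lies outside the claim.\<close>
  define F where "F n = {z (n - 1)}" for n
  have "F n \<subseteq> A n" if "n \<ge> 1" for n
    using z(1)[of "n - 1"] that by (simp add: F_def)
  moreover have "range z \<subseteq> (\<Union>n\<in>{1..}. F n)"
    by (auto simp: F_def intro!: bexI[of _ "Suc _"])
  then have "y \<in> Y closure_of (\<Union>n\<in>{1..}. F n)"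
    using z(2) closure_of_mono by blast
  ultimately show "\<exists>F. (\<forall>n\<ge>1. F n \<subseteq> A n \<and> finite (F n) \<and> card (F n) \<le> n) \<and>
             y \<in> Y closure_of (\<Union>n\<in>{1..}. F n)"
    by (intro exI[of _ F]) (auto simp: F_def)
qed

section \<open>Implications specific to the space of continuous functions\<close>

text \<open>A function that is 1 off \<open>V\<close> and has absolute value below 1 on an
  enlargement of \<open>B\<close> forces that enlargement into \<open>V\<close>. Approximating the
  zero function thus yields the covering property.\<close>

lemma S1_if_Id_fan_tightness:
  fixes \<BB> :: "'a::metric_space set set"
  assumes b: "bornology \<BB>" and Id: "Id_fan_tightness (strong_topology \<BB>)"
  shows "S1 (open_Bs_covers \<BB>) (open_Bs_covers \<BB>)"
  unfolding S1_def
proof (intro allI impI)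
  fix \<U> :: "nat \<Rightarrow> 'a set set"
  assume "\<forall>n. \<U> n \<in> open_Bs_covers \<BB>"
  then have U: "\<And>n V. V \<in> \<U> n \<Longrightarrow> open V" "\<And>n. UNIV \<notin> \<U> n"
    "\<And>n B. B \<in> \<BB> \<Longrightarrow> \<exists>V\<in>\<U> n. \<exists>\<delta>>0. enlargement B \<delta> \<subseteq> V"
    unfolding open_Bs_covers_def by auto
  \<comment> \<open>Pairing makes the blocks disjoint: block \<open>n\<close> has the indices
    \<open>prod_encode (n, i)\<close> with i < n. The set \<open>V\<close> may vary with
    \<open>i\<close>.\<close>
  define A where "A n = {g \<in> C_space. \<forall>i<n. \<exists>V\<in>\<U> (prod_encode (n, i)). \<forall>x. x \<notin> V \<longrightarrow> g x = (1::real)}"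
    for n
  let ?z = "\<lambda>_::'a. 0::real"
  have z: "?z \<in> C_space" unfolding C_space_def by simp
  have "?z \<in> strong_topology \<BB> closure_of A n" if "n \<ge> 1" for n
    unfolding in_closure_of_strong_topology[OF b z]
  proof (intro ballI allI impI)
    fix B and \<epsilon> :: real assume B: "B \<in> \<BB>" and e: "\<epsilon> > 0"
    obtain V \<delta> where V: "\<And>i. V i \<in> \<U> (prod_encode (n, i))" "\<And>i. \<delta> i > 0"
      "\<And>i. enlargement B (\<delta> i) \<subseteq> V i"
    proof -
      have "\<forall>i. \<exists>V \<delta>. V \<in> \<U> (prod_encode (n, i)) \<and> \<delta> > 0 \<and> enlargement B \<delta> \<subseteq> V"
        using U(3)[OF B] by blast
      then show thesis using that by metis
    qed
    \<comment> \<open>One radius for all \<open>n\<close> covers puts a single function into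
      \<open>A n\<close>; the minimum is over a nonempty set because n \<ge> 1.\<close>
    define d where "d = Min (\<delta> ` {..<n})"
    have "d > 0" unfolding d_def using that V(2) by (subst Min_gr_iff) (auto simp: lessThan_empty_iff)
    have d: "enlargement B d \<subseteq> V i" if "i < n" for i
      using V(3)[of i] enlargement_mono[of B B d "\<delta> i"] that unfolding d_def by fastforce
    obtain g where g: "continuous_on UNIV g"
      "\<And>x. x \<in> enlargement B (d/2) \<Longrightarrow> g x = 0" "\<And>x. x \<notin> enlargement B d \<Longrightarrow> g x = (1::real)"
      using separating_function[OF \<open>d > 0\<close>, where B = B] by metis
    have "g \<in> A n" unfolding A_def C_space_def using g(1,3) d V(1) by blast
    moreover have "(?z, g) \<in> strong_entourage B \<epsilon>"
      unfolding strong_entourage_def using z g(1,2) e \<open>d > 0\<close>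
      by (auto simp: C_space_def intro!: exI[of _ "d/2"])
    ultimately show "\<exists>g\<in>A n. (?z, g) \<in> strong_entourage B \<epsilon>" by blast
  qed
  moreover have "A n \<subseteq> C_space" for n unfolding A_def by blast
  ultimately have H: "\<forall>n\<ge>1. A n \<subseteq> C_space \<and> ?z \<in> strong_topology \<BB> closure_of A n" by simp
  obtain F where "\<forall>n\<ge>1. F n \<subseteq> A n \<and> finite (F n) \<and> card (F n) \<le> n"
    and F0: "?z \<in> strong_topology \<BB> closure_of (\<Union>n\<in>{1..}. F n)"
    using Id[unfolded Id_fan_tightness_def topspace_strong_topology[OF b], THEN bspec, OF z,
      THEN spec, THEN mp, OF H] by (elim exE conjE) (rule that)
  then have F: "\<And>n. n \<ge> 1 \<Longrightarrow> F n \<subseteq> A n \<and> finite (F n) \<and> card (F n) \<le> n" by simp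
  \<comment> \<open>The cardinality bound enters here: \<open>F n\<close> is enumerated by indices
    below \<open>n\<close>, and values of \<open>h\<close> past its cardinality are
    arbitrary.\<close>
  have "\<exists>h. \<forall>f\<in>F n. \<exists>i<n. h i = f" if n: "n \<ge> 1" for n
  proof -
    obtain h where "bij_betw h {0..<card (F n)} (F n)"
      using F[OF n] ex_bij_betw_nat_finite by blast
    then have "F n = h ` {0..<card (F n)}" by (simp add: bij_betw_def)
    moreover have "card (F n) \<le> n" using F[OF n] by blast
    ultimately show ?thesis
      by (intro exI[of _ h]) (metis atLeastLessThan_iff imageE less_le_trans)
  qed
  then obtain h where h: "\<And>n f. n \<ge> 1 \<Longrightarrow> f \<in> F n \<Longrightarrow> \<exists>i<n. h n i = f" by metis
  \<comment> \<open>At the remaining indices any member of the cover will do; one exists because the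
    cover property applies to the empty set.\<close>
  have "\<exists>V\<in>\<U> (prod_encode (n, i)). i < n \<and> h n i \<in> A n \<longrightarrow> (\<forall>x. x \<notin> V \<longrightarrow> h n i x = 1)" for n i
  proof (cases "i < n \<and> h n i \<in> A n")
    case True
    then show ?thesis unfolding A_def by blast
  next
    case False
    then show ?thesis using U(3)[OF bornology_empty[OF b]] by blast
  qed
  then obtain V where V: "\<And>n i. V n i \<in> \<U> (prod_encode (n, i))"
    "\<And>n i x. i < n \<Longrightarrow> h n i \<in> A n \<Longrightarrow> x \<notin> V n i \<Longrightarrow> h n i x = 1"
    by metis
  define a where "a k = case_prod V (prod_decode k)" for k
  have a: "a k \<in> \<U> k" for k
    using V(1)[of "fst (prod_decode k)" "snd (prod_decode k)"] unfolding a_def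
    by (simp add: case_prod_beta)
  have "range a \<in> open_Bs_covers \<BB>"
  proof (rule open_Bs_coversI[OF b])
    show "open W" if "W \<in> range a" for W using that a U(1) by blast
    show "UNIV \<notin> range a" using a U(2) by (metis imageE)
    show "\<exists>W\<in>range a. \<exists>\<delta>>0. enlargement B \<delta> \<subseteq> W" if B: "B \<in> \<BB>" for B
    proof -
      \<comment> \<open>Tolerance 1 suffices, since the chosen functions take the value exactly 1
        off the selected sets.\<close>
      obtain n f where f: "n \<ge> 1" "f \<in> F n" "(?z, f) \<in> strong_entourage B 1"
        using F0 B unfolding in_closure_of_strong_topology[OF b z]
        by (metis UN_E atLeast_iff zero_less_one)
      then obtain i where i: "i < n" "h n i = f" using h by blast
      obtain \<delta> where \<delta>: "\<delta> > 0" "\<And>x. x \<in> enlargement B \<delta> \<Longrightarrow> \<bar>f x\<bar> < 1"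
        using f(3) unfolding strong_entourage_def by auto
      have "enlargement B \<delta> \<subseteq> V n i"
        using V(2)[OF i(1)] \<delta>(2) i(2) f(1,2) F by fastforce
      moreover have "V n i = a (prod_encode (n, i))" unfolding a_def by simp
      ultimately show ?thesis using \<delta>(1) by blast
    qed
  qed
  then show "\<exists>a. (\<forall>n. a n \<in> \<U> n) \<and> range a \<in> open_Bs_covers \<BB>" using a by blast
qed

text \<open>The open sets built from the networks form an admissible cover unless one of them is the
  whole space. Hence the case split on whether this happens at infinitely many indices.\<close>

lemma finite_sets_fan_tightness_if_S1:
  fixes \<BB> :: "'a::metric_space set set"
  assumes b: "bornology \<BB>" and S1: "S1 (open_Bs_covers \<BB>) (open_Bs_covers \<BB>)"
  shows "countable_strong_fan_tightness_finite_sets (strong_topology \<BB>)"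
  unfolding countable_strong_fan_tightness_finite_sets_def topspace_strong_topology[OF b]
proof (intro ballI allI impI)
  fix f and \<A> :: "nat \<Rightarrow> ('a \<Rightarrow> real) set set"
  assume f: "f \<in> C_space"
    and "\<forall>n. pi_network_at (strong_topology \<BB>) f (\<A> n) \<and> (\<forall>A\<in>\<A> n. finite A)"
  then have A: "\<And>n A. A \<in> \<A> n \<Longrightarrow> A \<subseteq> C_space" "\<And>n A. A \<in> \<A> n \<Longrightarrow> finite A"
    "\<And>n B \<epsilon>. B \<in> \<BB> \<Longrightarrow> \<epsilon> > 0 \<Longrightarrow> \<exists>A\<in>\<A> n. A \<subseteq> strong_entourage B \<epsilon> `` {f}"
    unfolding pi_network_at_strong_topology[OF b f] by blast+
  define W where "W n A = {x. \<forall>g\<in>A. \<bar>f x - g x\<bar> < inverse (real (Suc n))}" for n A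
  have W_cover: "\<exists>A\<in>\<A> n. \<exists>\<delta>>0. enlargement B \<delta> \<subseteq> W n A" if B: "B \<in> \<BB>" for n B
  proof -
    obtain A where A': "A \<in> \<A> n" "A \<subseteq> strong_entourage B (inverse (real (Suc n))) `` {f}"
      using A(3)[OF B, of "inverse (real (Suc n))" n] by auto
    then have "\<forall>g\<in>A. \<exists>\<delta>>0. \<forall>x\<in>enlargement B \<delta>. \<bar>f x - g x\<bar> < inverse (real (Suc n))"
      unfolding strong_entourage_def by blast
    then obtain \<delta> where \<delta>: "\<And>g. g \<in> A \<Longrightarrow> \<delta> g > 0"
      "\<And>g x. g \<in> A \<Longrightarrow> x \<in> enlargement B (\<delta> g) \<Longrightarrow> \<bar>f x - g x\<bar> < inverse (real (Suc n))"
      by metis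
    \<comment> \<open>Finiteness of \<open>A\<close> provides a common radius; inserting 1 covers
      the case that \<open>A\<close> is empty.\<close>
    define d where "d = Min (insert 1 (\<delta> ` A))"
    have fin: "finite (insert 1 (\<delta> ` A))" using A(2)[OF A'(1)] by blast
    then have "d > 0" unfolding d_def using \<delta>(1) by (subst Min_gr_iff) auto
    moreover have "d \<le> \<delta> g" if "g \<in> A" for g unfolding d_def using fin that by auto
    then have "enlargement B d \<subseteq> W n A"
      unfolding W_def using \<delta>(2) enlargement_mono[of B B d] by blast
    ultimately show ?thesis using A'(1) by blast
  qed
  \<comment> \<open>The way back from covers to functions: one enlargement serves all members of
    \<open>A\<close> once the tolerance is below \<epsilon>.\<close>
  have W_close: "A \<subseteq> strong_entourage B \<epsilon> `` {f}"
    if "A \<in> \<A> n" "\<delta> > 0" "enlargement B \<delta> \<subseteq> W n A" "inverse (real (Suc n)) < \<epsilon>" for A n B \<delta> \<epsilon>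
    using that A(1)[OF that(1)] f unfolding W_def strong_entourage_def by fastforce
  have W_open: "open (W n A)" if "A \<in> \<A> n" for n A
  proof -
    have "W n A = (\<Inter>g\<in>A. {x. \<bar>f x - g x\<bar> < inverse (real (Suc n))})" unfolding W_def by blast
    moreover have "open {x. \<bar>f x - g x\<bar> < inverse (real (Suc n))}" if "g \<in> A" for g
      using f A(1)[OF \<open>A \<in> \<A> n\<close>] that unfolding C_space_def
      by (intro open_Collect_less continuous_intros) auto
    ultimately show ?thesis using A(2)[OF that] by (simp add: open_INT)
  qed
  have ex_index: "\<exists>k. \<forall>n\<ge>k. inverse (real (Suc n)) < \<epsilon>" if e: "\<epsilon> > 0" for \<epsilon>
  proof -
    obtain k where k: "inverse (real (Suc k)) < \<epsilon>" using reals_Archimedean[OF e] by blast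
    have "inverse (real (Suc n)) \<le> inverse (real (Suc k))" if "n \<ge> k" for n
      using that by (intro le_imp_inverse_le) auto
    then show ?thesis using k by (meson le_less_trans)
  qed
  have "\<exists>A. (\<forall>n. A n \<in> \<A> n) \<and> (\<forall>B\<in>\<BB>. \<forall>\<epsilon>>0. \<exists>n. A n \<subseteq> strong_entourage B \<epsilon> `` {f})"
  proof (cases "\<forall>k. \<exists>n\<ge>k. UNIV \<in> W n ` \<A> n")
    case True
    \<comment> \<open>Members whose set is the whole space are preferred, as they are close to
      \<open>f\<close> everywhere, whatever \<open>B\<close> is. Elsewhere any member is
      taken.\<close>
    have "\<exists>A\<in>\<A> n. UNIV \<in> W n ` \<A> n \<longrightarrow> W n A = UNIV" for n
      using W_cover[OF bornology_empty[OF b], of n] by (metis imageE)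
    then obtain A where A': "\<And>n. A n \<in> \<A> n" "\<And>n. UNIV \<in> W n ` \<A> n \<Longrightarrow> W n (A n) = UNIV"
      by metis
    have "\<exists>n. A n \<subseteq> strong_entourage B \<epsilon> `` {f}" if e: "\<epsilon> > 0" for B \<epsilon>
    proof -
      obtain k where k: "\<And>n. n \<ge> k \<Longrightarrow> inverse (real (Suc n)) < \<epsilon>" using ex_index[OF e] by blast
      obtain n where "n \<ge> k" "UNIV \<in> W n ` \<A> n" using True by blast
      then have "inverse (real (Suc n)) < \<epsilon>" "W n (A n) = UNIV" using k A'(2) by metis+
      then show ?thesis using W_close[OF A'(1), of 1 B n \<epsilon>] by auto
    qed
    then show ?thesis using A'(1) by blast
  next
    case False
    then obtain N where N: "\<And>n. n \<ge> N \<Longrightarrow> UNIV \<notin> W n ` \<A> n" by blast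
    \<comment> \<open>Dropping the first \<open>N\<close> networks removes every occurrence of the
      whole space, so the selection principle applies to the tail.\<close>
    have "W (n + N) ` \<A> (n + N) \<in> open_Bs_covers \<BB>" for n
      using W_open N[of "n + N"] W_cover by (intro open_Bs_coversI[OF b]) auto
    then have H: "\<forall>n. W (n + N) ` \<A> (n + N) \<in> open_Bs_covers \<BB>" ..
    obtain a where a: "\<forall>n. a n \<in> W (n + N) ` \<A> (n + N)" "range a \<in> open_Bs_covers \<BB>"
      using S1[unfolded S1_def, THEN spec, THEN mp, OF H]
      by (elim exE conjE) (rule that)
    have "\<exists>A\<in>\<A> (n + N). a n = W (n + N) A" for n using a(1)[THEN spec, of n] by (elim imageE) auto
    then obtain A' where A': "\<And>n. A' n \<in> \<A> (n + N)" "\<And>n. a n = W (n + N) (A' n)"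
      by metis
    \<comment> \<open>The first \<open>N\<close> choices are arbitrary: enlarging the selected
      family cannot destroy the \<pi>-network property.\<close>
    have "\<exists>A\<in>\<A> n. n \<ge> N \<longrightarrow> A = A' (n - N)" for n
      using A'(1)[of "n - N"] W_cover[OF bornology_empty[OF b], of n]
      by (cases "n \<ge> N") auto
    then obtain A where "\<And>n. A n \<in> \<A> n" "\<And>n. n \<ge> N \<Longrightarrow> A n = A' (n - N)" by metis
    moreover from this(2) have "A (n + N) = A' n" for n by simp
    moreover have "\<exists>n. A' n \<subseteq> strong_entourage B \<epsilon> `` {f}" if B: "B \<in> \<BB>" and e: "\<epsilon> > 0" for B \<epsilon>
    proof -
      obtain k where k: "\<And>n. n \<ge> k \<Longrightarrow> inverse (real (Suc n)) < \<epsilon>" using ex_index[OF e] by blast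
      obtain n \<delta> where "n \<ge> k" "\<delta> > 0" "enlargement B \<delta> \<subseteq> a n"
        using open_Bs_cover_large_index[OF b a(2) B] .
      then show ?thesis using W_close[OF A'(1), of \<delta> B n \<epsilon>] k[of "n + N"] A'(2) by auto
    qed
    ultimately show ?thesis by metis
  qed
  then obtain A' where A': "\<forall>n. A' n \<in> \<A> n"
    and "\<forall>B\<in>\<BB>. \<forall>\<epsilon>>0. \<exists>n. A' n \<subseteq> strong_entourage B \<epsilon> `` {f}"
    by (elim exE conjE)
  moreover have "A' n \<subseteq> C_space" for n using A(1) A' by metis
  ultimately have "pi_network_at (strong_topology \<BB>) f (range A')"
    unfolding pi_network_at_strong_topology[OF b f] by auto
  then show "\<exists>A. (\<forall>n. A n \<in> \<A> n) \<and> pi_network_at (strong_topology \<BB>) f (range A)"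
    using A' by (intro exI[of _ A'] conjI)
qed

theorem theorem3p4:
  fixes \<BB> :: "'a::metric_space set set"
  assumes "infinite (UNIV :: 'a set)"
    and "bornology \<BB>"
    and "has_closed_base \<BB>"
    and "UNIV \<notin> \<BB>"
  shows "(countable_strong_fan_tightness (strong_topology \<BB>) \<longleftrightarrow>
          countable_strong_fan_tightness_finite_sets (strong_topology \<BB>)) \<and>
         (countable_strong_fan_tightness_finite_sets (strong_topology \<BB>) \<longleftrightarrow>
          Id_fan_tightness (strong_topology \<BB>)) \<and>
         (Id_fan_tightness (strong_topology \<BB>) \<longleftrightarrow>
          S1 (open_Bs_covers \<BB>) (open_Bs_covers \<BB>))"
  \<comment> \<open>The implications close the cycle (2) to (1) to (3) to (4) to (2).\<close>
  using strong_fan_tightness_if_finite_sets Id_fan_tightness_if_strong_fan_tightness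
    S1_if_Id_fan_tightness[OF assms(2)] finite_sets_fan_tightness_if_S1[OF assms(2)]
  by blast

end
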